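(* Let $X$, $\mu$ and $\varphi:X\to X$ be the one-circuit directed graph with branching vertices $x_1,\dots,x_\kappa$, the measure and the parent map described in the context, and suppose that the composition operator $C_\varphi f=f\circ\varphi$ is bounded on $L^2(\mu)$ and is a quasi-$2$-isometry. Then the following statements are true: (a) If $\kappa=1$, then $C_\varphi$ satisfies the kernel condition if and only if $h(x_1)=h(x^1_{i,1})$ for all $i\in J_{[1,\eta_1]}$. (b) If $\kappa=2$, then $C_\varphi$ satisfies the kernel condition if and only if $h(x_1)=h(x^2_{i,1})$ for all $i\in J_{[1,\eta_2]}$ and $h(x_2)=h(x^1_{i,1})$ for all $i\in J_{[1,\eta_1]}$.
   Context: Notation: $\mathbb N=\{1,2,\dots\}$, $\mathbb Z_+=\{0,1,2,\dots\}$. $J_{[a,b]}$ denotes the set of integers $i$ with $a\le i\le b$ (so $J_{[1,0]}=\emptyset$ and $J_{[1,\infty]}=\mathbb N$). Setting: let $\kappa\in\mathbb N$ and $\eta_1,\dots,\eta_\kappa\in\mathbb Z_+\cup\{\infty\}$, at least one $\eta_r$ nonzero. Let $X=\{x_1,\dots,x_\kappa\}\cup\bigcup_{r=1}^{\kappa}\{x^r_{i,j}: i\in J_{[1,\eta_r]},\ j\in\mathbb N\}$ (all listed points distinct), with the $\sigma$-algebra of all subsets and a measure $\mu$ with $0<\mu(x):=\mu(\{x\})<\infty$ for every $x\in X$. $\Phi_2:\mathbb Z\to J_{[1,\kappa]}$ is the function for which there is a (unique) $\Phi_1:\mathbb Z\to\mathbb Z$ with $p=\Phi_1(p)\kappa+\Phi_2(p)$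 for all $p\in\mathbb Z$. The map $\varphi:X\to X$ is the parent map: $\varphi(x^r_{i,j+1})=x^r_{i,j}$ and $\varphi(x^r_{i,1})=x_r$ for $r\in J_{[1,\kappa]}$, $i\in J_{[1,\eta_r]}$, $j\in\mathbb N$, and $\varphi(x_{\Phi_2(1+r)})=x_r$ for $r\in J_{[1,\kappa]}$. Functions in $L^2(\mu)$ are complex valued. $h=\frac{d(\mu\circ\varphi^{-1})}{d\mu}$ is the Radon–Nikodym derivative, i.e. $h(x)=\mu(\varphi^{-1}(\{x\}))/\mu(x)$. Definitions: a bounded operator $T$ on a Hilbert space is a quasi-$2$-isometry if $T^*(T^{*2}T^2-2T^*T+I)T=0$. $T$ satisfies the kernel condition if $T^*T(\mathcal N(T^* ))\subseteq\mathcal N(T^* )$, where $\mathcal N$ denotes the null space. *)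

theory Defs
  imports "HOL-Analysis.Analysis" "HOL-Library.Extended_Nat"
begin

section \<open>Operators on the Hilbert space of square integrable functions\<close>

text \<open>
  Elements of $L^2(\mu)$ are represented by square integrable functions, and equality in
  $L^2(\mu)$ is equality almost everywhere. An operator acts on representatives.
\<close>

definition L2_space :: "'a measure \<Rightarrow> ('a \<Rightarrow> complex) set" where
  "L2_space M = {f \<in> borel_measurable M. integrable M (\<lambda>x. (cmod (f x))\<^sup>2)}"

definition L2_inner :: "'a measure \<Rightarrow> ('a \<Rightarrow> complex) \<Rightarrow> ('a \<Rightarrow> complex) \<Rightarrow> complex" where
  "L2_inner M f g = (LINT x|M. f x * cnj (g x))"

definition L2_norm :: "'a measure \<Rightarrow> ('a \<Rightarrow> complex) \<Rightarrow> real" where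
  "L2_norm M f = sqrt (LINT x|M. (cmod (f x))\<^sup>2)"

text \<open>
  The norm bound and linearity almost everywhere force the operator to respect equality
  almost everywhere, so this need not be demanded separately.
\<close>

definition bounded_operator_L2 ::
    "'a measure \<Rightarrow> (('a \<Rightarrow> complex) \<Rightarrow> 'a \<Rightarrow> complex) \<Rightarrow> bool" where
  "bounded_operator_L2 M T \<longleftrightarrow>
     (\<forall>f\<in>L2_space M. T f \<in> L2_space M) \<and>
     (\<forall>f\<in>L2_space M. \<forall>g\<in>L2_space M.
        AE x in M. T (\<lambda>y. f y + g y) x = T f x + T g x) \<and>
     (\<forall>c. \<forall>f\<in>L2_space M. AE x in M. T (\<lambda>y. c * f y) x = c * T f x) \<and>
     (\<exists>b. \<forall>f\<in>L2_space M. L2_norm M (T f) \<le> b * L2_norm M f)"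

text \<open>
  For a bounded operator, the value of the adjoint exists by the Riesz representation theorem
  and is unique up to equality almost everywhere; the choice only picks a representative.
  That representative does not change if \<open>g\<close> is altered on a null set.
\<close>

definition adjoint_L2 :: "'a measure \<Rightarrow> (('a \<Rightarrow> complex) \<Rightarrow> 'a \<Rightarrow> complex) \<Rightarrow>
    ('a \<Rightarrow> complex) \<Rightarrow> 'a \<Rightarrow> complex" where
  "adjoint_L2 M T g =
     (SOME k. k \<in> L2_space M \<and> (\<forall>f\<in>L2_space M. L2_inner M (T f) g = L2_inner M f k))"

definition null_space_L2 :: "'a measure \<Rightarrow> (('a \<Rightarrow> complex) \<Rightarrow> 'a \<Rightarrow> complex) \<Rightarrow>
    ('a \<Rightarrow> complex) set" where
  "null_space_L2 M T = {f \<in> L2_space M. AE x in M. T f x = 0}"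

definition quasi_2_isometry :: "'a measure \<Rightarrow> (('a \<Rightarrow> complex) \<Rightarrow> 'a \<Rightarrow> complex) \<Rightarrow> bool" where
  "quasi_2_isometry M T \<longleftrightarrow>
     (let A = adjoint_L2 M T in
      \<forall>f\<in>L2_space M. AE x in M.
        A (\<lambda>y. A (A (T (T (T f)))) y - 2 * A (T (T f)) y + T f y) x = 0)"

definition kernel_condition :: "'a measure \<Rightarrow> (('a \<Rightarrow> complex) \<Rightarrow> 'a \<Rightarrow> complex) \<Rightarrow> bool" where
  "kernel_condition M T \<longleftrightarrow>
     (\<lambda>f. adjoint_L2 M T (T f)) ` null_space_L2 M (adjoint_L2 M T)
       \<subseteq> null_space_L2 M (adjoint_L2 M T)"

definition composition_operator :: "('a \<Rightarrow> 'a) \<Rightarrow> ('a \<Rightarrow> complex) \<Rightarrow> 'a \<Rightarrow> complex" where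
  "composition_operator \<phi> f = f \<circ> \<phi>"

definition pushforward_density :: "'a measure \<Rightarrow> ('a \<Rightarrow> 'a) \<Rightarrow> 'a \<Rightarrow> ennreal" where
  "pushforward_density M \<phi> = RN_deriv M (distr M M \<phi>)"

lemma pushforward_density_eq:
  assumes "countable (space M)" "sets M = Pow (space M)"
    and "\<And>x. x \<in> space M \<Longrightarrow> 0 < emeasure M {x} \<and> emeasure M {x} < \<infinity>"
    and "\<phi> \<in> space M \<rightarrow> space M" "x \<in> space M"
  shows "pushforward_density M \<phi> x = emeasure M (\<phi> -` {x} \<inter> space M) / emeasure M {x}"
proof -
  let ?N = "distr M M \<phi>" and ?q = "\<lambda>x. emeasure M (\<phi> -` {x} \<inter> space M) / emeasure M {x}"
  have meas: "f \<in> measurable M N" if "f \<in> space M \<rightarrow> space N" for f and N :: "'b measure"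
    using that assms(2) by (auto simp: measurable_def)
  have N: "emeasure ?N {y} = emeasure M (\<phi> -` {y} \<inter> space M)" if "y \<in> space M" for y
    using that assms(2,4) by (intro emeasure_distr) (auto simp: measurable_def)
  have q: "emeasure (density M g) {y} = g y * emeasure M {y}" if "y \<in> space M" for y and g :: "'a \<Rightarrow> ennreal"
  proof -
    have "emeasure (density M g) {y} = (\<integral>\<^sup>+ z. g z * indicator {y} z \<partial>M)"
      using that assms(2) by (intro emeasure_density meas) auto
    also have "\<dots> = g y * emeasure M {y}"
      using that assms(2) by (subst nn_integral_indicator_singleton) auto
    finally show ?thesis .
  qed
  have "density M ?q = ?N"
  proof (rule measure_eqI_countable[where A = "space M"])
    fix y assume y: "y \<in> space M"
    show "emeasure (density M ?q) {y} = emeasure ?N {y}"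
      using assms(3)[OF y] ennreal_divide_self[of "emeasure M {y}"]
      by (simp add: q[OF y] N[OF y] ennreal_divide_times less_imp_neq[symmetric])
  qed (use assms in auto)
  moreover have "?q \<in> borel_measurable M"
    by (rule meas) auto
  ultimately have "density M (RN_deriv M ?N) = ?N"
    by (intro RN_derivI)
  then have "RN_deriv M ?N x * emeasure M {x} = emeasure M (\<phi> -` {x} \<inter> space M)"
    using q[OF assms(5), of "RN_deriv M ?N"] N[OF assms(5)] by simp
  then show ?thesis
    using assms(3)[OF assms(5)]
      mult_divide_eq_ennreal[of "emeasure M {x}" "RN_deriv M ?N x"]
    by (auto simp: pushforward_density_def less_top[symmetric])
qed

section \<open>The directed graph with one circuit\<close>

text \<open>
  \<open>Circ r\<close> is $x_r$ and \<open>Branch r i j\<close> is $x^r_{i,j}$; only the indices singled out by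
  \<open>vertices\<close> belong to the graph.
\<close>

datatype vertex = Circ nat | Branch nat nat nat

definition J1 :: "enat \<Rightarrow> nat set" where
  "J1 n = {i. 1 \<le> i \<and> enat i \<le> n}"

definition vertices :: "nat \<Rightarrow> (nat \<Rightarrow> enat) \<Rightarrow> vertex set" where
  "vertices \<kappa> \<eta> = {Circ r | r. r \<in> {1..\<kappa>}} \<union>
     {Branch r i j | r i j. r \<in> {1..\<kappa>} \<and> i \<in> J1 (\<eta> r) \<and> 1 \<le> j}"

definition Phi2 :: "nat \<Rightarrow> int \<Rightarrow> nat" where
  "Phi2 \<kappa> p = (THE r. r \<in> {1..\<kappa>} \<and> (\<exists>q::int. p = q * int \<kappa> + int r))"

text \<open>
  On the circuit, $\varphi(x_{\Phi_2(1+r)}) = x_r$, so the parent of $x_s$ is the $x_r$ with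
  $\Phi_2(1+r) = s$. Values outside the graph are irrelevant.
\<close>

fun parent :: "nat \<Rightarrow> vertex \<Rightarrow> vertex" where
  "parent \<kappa> (Circ s) = Circ (THE r. r \<in> {1..\<kappa>} \<and> Phi2 \<kappa> (1 + int r) = s)"
| "parent \<kappa> (Branch r i j) = (if j \<le> 1 then Circ r else Branch r i (j - 1))"

lemma Phi2_Suc:
  assumes "r \<in> {1..\<kappa>}"
  shows "Phi2 \<kappa> (1 + int r) = (if r = \<kappa> then 1 else r + 1)"
  unfolding Phi2_def
proof (rule the_equality)
  show "(if r = \<kappa> then 1 else r + 1) \<in> {1..\<kappa>} \<and>
      (\<exists>q::int. 1 + int r = q * int \<kappa> + int (if r = \<kappa> then 1 else r + 1))"
    using assms by (intro conjI exI[of _ "if r = \<kappa> then 1 else 0"]) auto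
next
  fix s assume s: "s \<in> {1..\<kappa>} \<and> (\<exists>q::int. 1 + int r = q * int \<kappa> + int s)"
  then obtain q where "1 + int r = q * int \<kappa> + int s"
    by blast
  then have "int r = (int s - 1) + q * int \<kappa>"
    by linarith
  then have "(int s - 1) mod int \<kappa> = int r mod int \<kappa>"
    by simp
  moreover have "(int s - 1) mod int \<kappa> = int s - 1"
    using s by (intro mod_pos_pos_trivial) auto
  ultimately have s_eq: "int s = int r mod int \<kappa> + 1"
    by linarith
  show "s = (if r = \<kappa> then 1 else r + 1)"
  proof (cases "r = \<kappa>")
    case True
    then show ?thesis using s_eq by simp
  next
    case False
    then have "int r mod int \<kappa> = int r"
      using assms by (intro mod_pos_pos_trivial) auto
    then show ?thesis using s_eq False by simp
  qed
qed

lemma parent_Circ_Phi2: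
  assumes "r \<in> {1..\<kappa>}"
  shows "parent \<kappa> (Circ (Phi2 \<kappa> (1 + int r))) = Circ r"
proof -
  have inj: "t = r" if t: "t \<in> {1..\<kappa>}" and eq: "Phi2 \<kappa> (1 + int t) = Phi2 \<kappa> (1 + int r)" for t
  proof -
    have "(if t = \<kappa> then 1 else t + 1) = (if r = \<kappa> then 1 else r + 1)"
      using eq by (simp only: Phi2_Suc[OF t] Phi2_Suc[OF assms])
    with t assms show ?thesis
      by (cases "t = \<kappa>"; cases "r = \<kappa>") auto
  qed
  have "(THE t. t \<in> {1..\<kappa>} \<and> Phi2 \<kappa> (1 + int t) = Phi2 \<kappa> (1 + int r)) = r"
    by (rule the_equality) (use assms inj in blast)+
  then show ?thesis
    by (simp only: parent.simps)
qed

end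

theory Submission
  imports Defs
begin

text \<open>
  Write \<open>C\<close> for the composition operator of \<open>\<phi>\<close> and \<open>h x = \<mu>(\<phi>\<^sup>-\<^sup>1{x}) / \<mu>{x}\<close>. On a space whose
  points all have positive measure, everything happens separately on the fibres of \<open>\<phi>\<close>. The adjoint
  sends \<open>g\<close> to the function whose value at \<open>x\<close> is the integral of \<open>g\<close> over the fibre of \<open>x\<close>
  divided by \<open>\<mu>{x}\<close> (\<open>adjoint_eq\<close>). Hence the null space of the adjoint consists of the
  functions whose integral over each fibre vanishes, and \<open>C\<^sup>* C\<close> is multiplication by \<open>h\<close>.
  Multiplication by \<open>h\<close> preserves the functions with vanishing fibre integrals exactly when \<open>h\<close> is
  constant on each fibre: a factor that is constant on a fibre can be pulled out of the integral,
  and conversely \<open>h y = h z\<close> follows by testing with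
  \<open>1\<^bsub>{y}\<^esub> / \<mu>{y} - 1\<^bsub>{z}\<^esub> / \<mu>{z}\<close> for two points of the same fibre
  (\<open>kernel_condition_iff\<close>).

  In the graph the fibre of a vertex off the circuit has one point, while the fibre of \<open>x\<^sub>r\<close>
  consists of the next circuit vertex and the first vertices of the branches at \<open>x\<^sub>r\<close>
  (\<open>constant_on_siblings_iff\<close>). For one or two circuit vertices this is the asserted criterion.

  The work lies in the adjoint: it is defined by a choice among the functions with the right inner
  products, so such a function must be exhibited before anything is known about it. That the
  fibrewise formula yields a square integrable function is Cauchy-Schwarz on each fibre together
  with boundedness of \<open>C\<close>, which, tested on indicators of points, says that \<open>h\<close> is bounded.
\<close>

section \<open>Measures with countably many atoms\<close>

locale atomic_measure =
  fixes M :: "'a measure"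
  assumes countable_space: "countable (space M)"
    and sets_eq: "sets M = Pow (space M)"
    and atoms: "\<And>x. x \<in> space M \<Longrightarrow> 0 < emeasure M {x} \<and> emeasure M {x} < \<infinity>"
begin

lemma measurable_any: "f \<in> space M \<rightarrow> space N \<Longrightarrow> f \<in> measurable M N"
  by (auto simp: measurable_def sets_eq)

lemma borel_measurable_any [measurable, simp]: "f \<in> borel_measurable M"
  by (rule measurable_any) auto

lemma measure_atom_pos: "x \<in> space M \<Longrightarrow> 0 < measure M {x}"
  using atoms[of x] by (simp add: measure_def enn2real_positive_iff)

lemma emeasure_atom: "x \<in> space M \<Longrightarrow> emeasure M {x} = ennreal (measure M {x})"
  using atoms[of x] by (intro emeasure_eq_ennreal_measure) auto

lemma AE_iff_all: "(AE x in M. P x) \<longleftrightarrow> (\<forall>x\<in>space M. P x)"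
proof
  assume "AE x in M. P x"
  then obtain N where N: "{x \<in> space M. \<not> P x} \<subseteq> N" "emeasure M N = 0" "N \<in> sets M"
    by (rule AE_E)
  show "\<forall>x\<in>space M. P x"
  proof (rule ballI, rule ccontr)
    fix x assume "x \<in> space M" "\<not> P x"
    with N have "emeasure M {x} \<le> emeasure M N"
      by (intro emeasure_mono) auto
    with N atoms[OF \<open>x \<in> space M\<close>] show False by simp
  qed
qed (auto intro: AE_I2)

sublocale sigma_finite_measure M
proof
  show "\<exists>A. countable A \<and> A \<subseteq> sets M \<and> \<Union> A = space M \<and> (\<forall>a\<in>A. emeasure M a \<noteq> \<infinity>)"
    using countable_space less_imp_neq[OF conjunct2[OF atoms]]
    by (intro exI[of _ "(\<lambda>x. {x}) ` space M"]) (auto simp: sets_eq)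
qed

text \<open>
  Every point lies in exactly one fibre, so this is an exchange of the integral over \<open>M\<close> with the
  sum over the base points. With the identity for \<open>\<phi>\<close> it expresses an integral as a weighted sum
  over the points.
\<close>

lemma nn_integral_fibres:
  fixes u :: "'a \<Rightarrow> ennreal"
  assumes "\<phi> \<in> space M \<rightarrow> space M"
  shows "(\<integral>\<^sup>+y. u y \<partial>M) =
    (\<integral>\<^sup>+x. (\<integral>\<^sup>+y. u y * indicator {z \<in> space M. \<phi> z = x} y \<partial>M) \<partial>count_space (space M))"
proof -
  have "(\<integral>\<^sup>+x. (\<integral>\<^sup>+y. u y * indicator {z \<in> space M. \<phi> z = x} y \<partial>M) \<partial>count_space (space M)) =
    (\<integral>\<^sup>+y. (\<integral>\<^sup>+x. u y * indicator {z \<in> space M. \<phi> z = x} y \<partial>count_space (space M)) \<partial>M)"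
    by (rule nn_integral_count_space_nn_integral[symmetric]) (auto simp: countable_space)
  also have "\<dots> = (\<integral>\<^sup>+y. u y \<partial>M)"
  proof (rule nn_integral_cong)
    fix y assume y: "y \<in> space M"
    then have "\<phi> y \<in> space M" using assms by auto
    have "(\<integral>\<^sup>+x. u y * indicator {z \<in> space M. \<phi> z = x} y \<partial>count_space (space M)) =
      (\<integral>\<^sup>+x. u y * indicator {\<phi> y} x \<partial>count_space (space M))"
      using y by (intro nn_integral_cong) (auto split: split_indicator)
    also have "\<dots> = u y"
      using \<open>\<phi> y \<in> space M\<close> by (subst nn_integral_indicator_singleton) auto
    finally show "(\<integral>\<^sup>+x. u y * indicator {z \<in> space M. \<phi> z = x} y \<partial>count_space (space M)) = u y" .
  qed
  finally show ?thesis ..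
qed

lemma nn_integral_atoms:
  fixes u :: "'a \<Rightarrow> ennreal"
  shows "(\<integral>\<^sup>+y. u y \<partial>M) = (\<integral>\<^sup>+x. u x * emeasure M {x} \<partial>count_space (space M))"
proof -
  have "(\<integral>\<^sup>+y. u y \<partial>M) =
      (\<integral>\<^sup>+x. (\<integral>\<^sup>+y. u y * indicator {z \<in> space M. z = x} y \<partial>M) \<partial>count_space (space M))"
    by (rule nn_integral_fibres) simp
  also have "\<dots> = (\<integral>\<^sup>+x. u x * emeasure M {x} \<partial>count_space (space M))"
  proof (rule nn_integral_cong)
    fix x assume "x \<in> space (count_space (space M))"
    then have "{z \<in> space M. z = x} = {x}" "{x} \<in> sets M"
      by (auto simp: sets_eq)
    then show "(\<integral>\<^sup>+y. u y * indicator {z \<in> space M. z = x} y \<partial>M) = u x * emeasure M {x}"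
      by (simp only: nn_integral_indicator_singleton)
  qed
  finally show ?thesis .
qed

text \<open>
  For complex functions the exchange is Fubini's theorem on the product with the counting measure;
  the nonnegative case gives the integrability that it requires.
\<close>

lemma integral_fibres:
  fixes u :: "'a \<Rightarrow> complex"
  assumes \<phi>: "\<phi> \<in> space M \<rightarrow> space M" and u: "integrable M u"
  shows "(LINT y|M. u y) =
    (LINT x|count_space (space M). (LINT y:{z \<in> space M. \<phi> z = x}|M. u y))"
proof -
  let ?C = "count_space (space M)"
  let ?F = "\<lambda>x y. indicator {z \<in> space M. \<phi> z = x} y *\<^sub>R u y"
  interpret C: sigma_finite_measure ?C
    by (rule sigma_finite_measure_count_space_countable) (rule countable_space)
  interpret P: pair_sigma_finite ?C M ..
  have F_meas: "case_prod ?F \<in> borel_measurable (?C \<Otimes>\<^sub>M M)"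
    by (rule measurable_pair_measure_countable1) (auto simp: countable_space)
  have "(\<integral>\<^sup>+p. norm (case_prod ?F p) \<partial>(?C \<Otimes>\<^sub>M M)) = (\<integral>\<^sup>+x. (\<integral>\<^sup>+y. norm (?F x y) \<partial>M) \<partial>?C)"
    using nn_integral_fst[of "\<lambda>p. ennreal (norm (case_prod ?F p))" ?C] F_meas by simp
  also have "\<dots> = (\<integral>\<^sup>+x. (\<integral>\<^sup>+y. ennreal (norm (u y)) * indicator {z \<in> space M. \<phi> z = x} y \<partial>M) \<partial>?C)"
    by (intro nn_integral_cong) (auto split: split_indicator)
  also have "\<dots> = (\<integral>\<^sup>+y. norm (u y) \<partial>M)"
    using nn_integral_fibres[OF \<phi>, of "\<lambda>y. ennreal (norm (u y))"] by simp
  also have "\<dots> < \<infinity>"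
    using u by (simp add: integrable_iff_bounded)
  finally have F_int: "integrable (?C \<Otimes>\<^sub>M M) (case_prod ?F)"
    using F_meas by (intro integrableI_bounded) auto
  have "(LINT x|?C. (LINT y:{z \<in> space M. \<phi> z = x}|M. u y)) = (LINT y|M. (LINT x|?C. ?F x y))"
    unfolding set_lebesgue_integral_def using P.Fubini_integral[OF F_int] by simp
  also have "\<dots> = (LINT y|M. u y)"
  proof (rule Bochner_Integration.integral_cong)
    fix y assume y: "y \<in> space M"
    then have \<phi>y: "\<phi> y \<in> space M" using \<phi> by auto
    have "(LINT x|?C. ?F x y) = (LINT x|?C. indicator {\<phi> y} x *\<^sub>R u y)"
      using y by (intro Bochner_Integration.integral_cong) (auto split: split_indicator)
    also have "\<dots> = u y"
      using \<phi>y by (subst integral_scaleR_left) auto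
    finally show "(LINT x|?C. ?F x y) = u y" .
  qed simp
  finally show ?thesis ..
qed

lemma set_integral_atom:
  fixes u :: "'a \<Rightarrow> complex"
  assumes "x \<in> space M"
  shows "(LINT y:{x}|M. u y) = of_real (measure M {x}) * u x"
proof -
  have "(LINT y:{x}|M. u y) = (LINT y|M. indicator {x} y *\<^sub>R u x)"
    unfolding set_lebesgue_integral_def
    by (intro Bochner_Integration.integral_cong) (auto split: split_indicator)
  also have "\<dots> = measure M {x} *\<^sub>R u x"
    using assms atoms[OF assms]
    by (intro has_bochner_integral_integral_eq has_bochner_integral_indicator) (auto simp: sets_eq)
  finally show ?thesis by (simp add: scaleR_conv_of_real)
qed

lemma integral_atoms:
  fixes u :: "'a \<Rightarrow> complex"
  assumes "integrable M u"
  shows "(LINT y|M. u y) = (LINT x|count_space (space M). of_real (measure M {x}) * u x)"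
proof -
  have "(LINT y|M. u y) = (LINT x|count_space (space M). (LINT y:{z \<in> space M. z = x}|M. u y))"
    by (rule integral_fibres) (use assms in auto)
  also have "\<dots> = (LINT x|count_space (space M). of_real (measure M {x}) * u x)"
  proof (rule Bochner_Integration.integral_cong)
    fix x assume "x \<in> space (count_space (space M))"
    then have "x \<in> space M" by simp
    moreover from this have "{z \<in> space M. z = x} = {x}" by auto
    ultimately show "(LINT y:{z \<in> space M. z = x}|M. u y) = of_real (measure M {x}) * u x"
      by (simp only: set_integral_atom)
  qed simp
  finally show ?thesis .
qed

lemma L2_space_iff: "f \<in> L2_space M \<longleftrightarrow> integrable M (\<lambda>x. (cmod (f x))\<^sup>2)"
  by (simp add: L2_space_def)

lemma L2_space_iff_nn: "f \<in> L2_space M \<longleftrightarrow> (\<integral>\<^sup>+x. ennreal ((cmod (f x))\<^sup>2) \<partial>M) < \<infinity>"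
  by (simp add: L2_space_iff integrable_iff_bounded)

lemma integrable_L2_mult:
  assumes "f \<in> L2_space M" "g \<in> L2_space M"
  shows "integrable M (\<lambda>x. f x * cnj (g x))"
proof (rule Bochner_Integration.integrable_bound)
  show "integrable M (\<lambda>x. (cmod (f x))\<^sup>2 + (cmod (g x))\<^sup>2)"
    using assms by (simp add: L2_space_iff)
  show "AE x in M. norm (f x * cnj (g x)) \<le> norm ((cmod (f x))\<^sup>2 + (cmod (g x))\<^sup>2)"
  proof (rule AE_I2)
    fix x
    have "0 \<le> (cmod (f x) - cmod (g x))\<^sup>2" "0 \<le> cmod (f x) * cmod (g x)"
      by simp_all
    then show "norm (f x * cnj (g x)) \<le> norm ((cmod (f x))\<^sup>2 + (cmod (g x))\<^sup>2)"
      unfolding norm_mult complex_mod_cnj real_norm_def power2_diff by linarith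
  qed
qed auto

lemma indicator_L2:
  assumes "A \<subseteq> space M"
  shows "(indicator A :: 'a \<Rightarrow> complex) \<in> L2_space M \<longleftrightarrow> emeasure M A < \<infinity>"
    and "L2_norm M (indicator A) = sqrt (measure M A)"
proof -
  have sq: "(\<lambda>x. (cmod (indicator A x))\<^sup>2) = (indicator A :: 'a \<Rightarrow> real)"
    by (auto split: split_indicator)
  have A: "A \<inter> space M = A" using assms by blast
  show "(indicator A :: 'a \<Rightarrow> complex) \<in> L2_space M \<longleftrightarrow> emeasure M A < \<infinity>"
    using assms unfolding L2_space_iff sq by (simp add: integrable_indicator_iff A sets_eq)
  show "L2_norm M (indicator A) = sqrt (measure M A)"
    unfolding L2_norm_def sq by (simp add: A)
qed

lemma set_integrable_L2:
  assumes "g \<in> L2_space M" "A \<subseteq> space M" "emeasure M A < \<infinity>"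
  shows "set_integrable M A g"
proof -
  have "integrable M (\<lambda>x. g x * cnj (indicator A x))"
    by (rule integrable_L2_mult) (use assms indicator_L2 in auto)
  then show ?thesis
    unfolding set_integrable_def
    by (rule Bochner_Integration.integrable_cong[THEN iffD1, rotated -1])
      (auto split: split_indicator)
qed

text \<open>
  Cauchy-Schwarz against the constant function \<open>1\<close> on \<open>A\<close>, obtained from the nonnegativity of
  the integral of \<open>(\<mu>(A) |g| - \<integral>\<^sub>A |g|)\<^sup>2\<close>.
\<close>

lemma set_integral_square_le:
  assumes g: "g \<in> L2_space M" and A: "A \<subseteq> space M" and fin: "emeasure M A < \<infinity>"
  shows "(cmod (LINT y:A|M. g y))\<^sup>2 \<le> measure M A * (LINT y:A|M. (cmod (g y))\<^sup>2)"
proof -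
  define m where "m = measure M A"
  define a where "a = (LINT y:A|M. cmod (g y))"
  define s where "s = (LINT y:A|M. (cmod (g y))\<^sup>2)"
  have AM: "A \<in> sets M" using A by (simp add: sets_eq)
  have i0: "set_integrable M A g" by (rule set_integrable_L2[OF g A fin])
  have i1: "set_integrable M A (\<lambda>y. cmod (g y))" by (rule set_integrable_norm[OF i0])
  have i2: "set_integrable M A (\<lambda>y. (cmod (g y))\<^sup>2)"
    using g AM unfolding L2_space_iff set_integrable_def by (intro integrable_mult_indicator)
  have i3: "set_integrable M A (\<lambda>y. 1 :: real)"
    using AM fin by (simp add: set_integrable_def)
  have one: "(LINT y:A|M. 1 :: real) = m"
    using A by (simp add: set_lebesgue_integral_def m_def Int_absorb2)
  \<comment> \<open>Scaling by \<open>m\<close> instead of subtracting the mean \<open>a / m\<close> avoids dividing by \<open>m\<close>.\<close>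
  have "0 \<le> (LINT y:A|M. (m * cmod (g y) - a)\<^sup>2)"
    unfolding set_lebesgue_integral_def by (rule Bochner_Integration.integral_nonneg) simp
  also have "(LINT y:A|M. (m * cmod (g y) - a)\<^sup>2) =
    (LINT y:A|M. (m\<^sup>2 * (cmod (g y))\<^sup>2 - 2 * m * a * cmod (g y)) + a\<^sup>2 * 1)"
    by (simp add: power2_diff power_mult_distrib mult_ac algebra_simps)
  also have "\<dots> = m\<^sup>2 * s - 2 * m * a * a + a\<^sup>2 * m"
    using i1 i2 i3
    by (simp only: set_integral_add set_integral_diff set_integrable_mult_right set_integral_mult_right
        one flip: s_def a_def)
  finally have ineq: "0 \<le> m * (m * s - a\<^sup>2)"
    by (simp add: power2_eq_square algebra_simps)
  have na: "cmod (LINT y:A|M. g y) \<le> a"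
    unfolding a_def by (rule set_integral_norm_bound[OF i0])
  have "a\<^sup>2 \<le> m * s"
  proof (cases "m = 0")
    case True
    then have "emeasure M A = 0"
      using fin by (simp add: m_def emeasure_eq_ennreal_measure)
    have "A = {}"
    proof (rule ccontr)
      assume "A \<noteq> {}"
      then obtain x where "x \<in> A" by blast
      then have "emeasure M {x} \<le> emeasure M A" by (intro emeasure_mono AM) auto
      then show False using atoms[of x] \<open>x \<in> A\<close> A \<open>emeasure M A = 0\<close> by auto
    qed
    then show ?thesis using True by (simp add: a_def set_lebesgue_integral_def)
  next
    case False
    then have "0 < m" by (simp add: m_def zero_less_measure_iff)
    then show ?thesis using ineq by (simp add: zero_le_mult_iff)
  qed
  moreover have "(cmod (LINT y:A|M. g y))\<^sup>2 \<le> a\<^sup>2"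
    using na by (intro power_mono) auto
  ultimately show ?thesis unfolding m_def s_def by linarith
qed

end

section \<open>The adjoint of a composition operator\<close>

locale bounded_composition = atomic_measure +
  fixes \<phi> :: "'a \<Rightarrow> 'a"
  assumes maps: "\<phi> \<in> space M \<rightarrow> space M"
    and bounded: "bounded_operator_L2 M (composition_operator \<phi>)"
begin

definition fibre :: "'a \<Rightarrow> 'a set" where
  "fibre x = {y \<in> space M. \<phi> y = x}"

definition weighted_average :: "('a \<Rightarrow> complex) \<Rightarrow> 'a \<Rightarrow> complex" where
  "weighted_average g x = (LINT y:fibre x|M. g y) / of_real (measure M {x})"

text \<open>
  The Radon-Nikodym derivative \<open>h\<close> as a real number; see \<open>pushforward_density_eq_iff\<close>.
\<close>

definition fibre_ratio :: "'a \<Rightarrow> real" where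
  "fibre_ratio x = measure M (fibre x) / measure M {x}"

lemma fibre_subset: "fibre x \<subseteq> space M"
  by (auto simp: fibre_def)

lemma composition_L2: "f \<in> L2_space M \<Longrightarrow> (\<lambda>y. f (\<phi> y)) \<in> L2_space M"
  using bounded by (auto simp: bounded_operator_L2_def composition_operator_def comp_def)

lemma indicator_composition_L2_norm:
  "L2_norm M (\<lambda>y. indicator {x} (\<phi> y)) = sqrt (measure M (fibre x))"
  and indicator_composition_L2:
  "(\<lambda>y. indicator {x} (\<phi> y)) \<in> L2_space M \<longleftrightarrow> emeasure M (fibre x) < \<infinity>"
proof -
  have eq: "cmod (indicator {x} (\<phi> y)) = cmod (indicator (fibre x) y)" if "y \<in> space M" for y
    using that by (auto simp: fibre_def split: split_indicator)
  have "L2_norm M (\<lambda>y. indicator {x} (\<phi> y)) = L2_norm M (indicator (fibre x))"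
    unfolding L2_norm_def by (simp add: eq cong: Bochner_Integration.integral_cong)
  then show "L2_norm M (\<lambda>y. indicator {x} (\<phi> y)) = sqrt (measure M (fibre x))"
    by (simp add: indicator_L2 fibre_subset)
  have "(\<lambda>y. indicator {x} (\<phi> y) :: complex) \<in> L2_space M \<longleftrightarrow>
      (indicator (fibre x) :: 'a \<Rightarrow> complex) \<in> L2_space M"
    unfolding L2_space_iff by (simp add: eq cong: Bochner_Integration.integrable_cong)
  then show "(\<lambda>y. indicator {x} (\<phi> y) :: complex) \<in> L2_space M \<longleftrightarrow> emeasure M (fibre x) < \<infinity>"
    by (simp add: indicator_L2 fibre_subset)
qed

lemma indicator_atom_L2: "x \<in> space M \<Longrightarrow> (indicator {x} :: 'a \<Rightarrow> complex) \<in> L2_space M"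
  using atoms[of x] by (simp add: indicator_L2)

lemma fibre_finite: "x \<in> space M \<Longrightarrow> emeasure M (fibre x) < \<infinity>"
  using composition_L2[OF indicator_atom_L2] indicator_composition_L2 by blast

text \<open>
  Boundedness of the operator, tested on the indicator of a point: its image is the indicator of
  the fibre.
\<close>

lemma fibre_measure_bound:
  obtains B where "0 \<le> B" "\<And>x. x \<in> space M \<Longrightarrow> measure M (fibre x) \<le> B * measure M {x}"
proof -
  obtain b where b: "\<And>f. f \<in> L2_space M \<Longrightarrow> L2_norm M (\<lambda>y. f (\<phi> y)) \<le> b * L2_norm M f"
    using bounded by (auto simp: bounded_operator_L2_def composition_operator_def comp_def)
  have "measure M (fibre x) \<le> b\<^sup>2 * measure M {x}" if x: "x \<in> space M" for x
  proof -
    have "sqrt (measure M (fibre x)) \<le> b * sqrt (measure M {x})"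
      using b[OF indicator_atom_L2[OF x]] indicator_L2(2)[of "{x}"] x
      by (simp add: indicator_composition_L2_norm)
    then have "(sqrt (measure M (fibre x)))\<^sup>2 \<le> (b * sqrt (measure M {x}))\<^sup>2"
      by (intro power_mono) auto
    then show ?thesis
      by (simp add: power_mult_distrib)
  qed
  then show thesis
    by (intro that[of "b\<^sup>2"]) auto
qed

text \<open>
  By Cauchy-Schwarz, \<open>|weighted_average g x|\<^sup>2 \<mu>{x}\<close> is at most \<open>h x\<close> times the integral of
  \<open>|g|\<^sup>2\<close> over the fibre of \<open>x\<close>. As \<open>h\<close> is bounded and the fibres partition the space, summing
  over \<open>x\<close> bounds the norm of the average by that of \<open>g\<close>.
\<close>

lemma weighted_average_L2:
  assumes g: "g \<in> L2_space M"
  shows "weighted_average g \<in> L2_space M"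
proof -
  obtain B where B: "0 \<le> B" "\<And>x. x \<in> space M \<Longrightarrow> measure M (fibre x) \<le> B * measure M {x}"
    using fibre_measure_bound by blast
  have "(\<integral>\<^sup>+x. ennreal ((cmod (weighted_average g x))\<^sup>2) \<partial>M) =
    (\<integral>\<^sup>+x. ennreal ((cmod (weighted_average g x))\<^sup>2) * emeasure M {x} \<partial>count_space (space M))"
    by (rule nn_integral_atoms)
  also have "\<dots> \<le> (\<integral>\<^sup>+x. ennreal B * (\<integral>\<^sup>+y. ennreal ((cmod (g y))\<^sup>2) * indicator (fibre x) y \<partial>M)
      \<partial>count_space (space M))"
  proof (rule nn_integral_mono)
    fix x assume "x \<in> space (count_space (space M))"
    then have x: "x \<in> space M" by simp
    define m where "m = measure M {x}"
    define s where "s = (LINT y:fibre x|M. (cmod (g y))\<^sup>2)"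
    have m: "0 < m" unfolding m_def by (rule measure_atom_pos[OF x])
    have s: "0 \<le> s"
      unfolding s_def set_lebesgue_integral_def by (rule Bochner_Integration.integral_nonneg) simp
    have "(cmod (weighted_average g x))\<^sup>2 * m = (cmod (LINT y:fibre x|M. g y))\<^sup>2 / m"
      using m by (simp add: weighted_average_def norm_divide power_divide power2_eq_square
          flip: m_def)
    also have "\<dots> \<le> measure M (fibre x) * s / m"
      using set_integral_square_le[OF g fibre_subset fibre_finite[OF x]] m
      by (intro divide_right_mono) (auto simp: s_def)
    also have "\<dots> \<le> B * m * s / m"
      using B(2)[OF x] m s by (intro divide_right_mono mult_right_mono) (auto simp: m_def)
    finally have le: "(cmod (weighted_average g x))\<^sup>2 * m \<le> B * s" using m by simp
    have "(\<integral>\<^sup>+y. ennreal ((cmod (g y))\<^sup>2) * indicator (fibre x) y \<partial>M) =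
      (\<integral>\<^sup>+y. ennreal (indicator (fibre x) y * (cmod (g y))\<^sup>2) \<partial>M)"
      by (intro nn_integral_cong) (auto split: split_indicator)
    also have "\<dots> = ennreal s"
      unfolding s_def set_lebesgue_integral_def real_scaleR_def
      using g integrable_mult_indicator[of "fibre x" M "\<lambda>y. (cmod (g y))\<^sup>2"] fibre_subset[of x]
      by (intro nn_integral_eq_integral) (auto simp: L2_space_iff sets_eq)
    finally have *: "(\<integral>\<^sup>+y. ennreal ((cmod (g y))\<^sup>2) * indicator (fibre x) y \<partial>M) = ennreal s" .
    have "emeasure M {x} = ennreal m"
      unfolding m_def by (rule emeasure_atom[OF x])
    then show "ennreal ((cmod (weighted_average g x))\<^sup>2) * emeasure M {x} \<le>
        ennreal B * (\<integral>\<^sup>+y. ennreal ((cmod (g y))\<^sup>2) * indicator (fibre x) y \<partial>M)"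
      using le m s B(1) unfolding * by (simp flip: ennreal_mult)
  qed
  also have "\<dots> = ennreal B * (\<integral>\<^sup>+y. ennreal ((cmod (g y))\<^sup>2) \<partial>M)"
    unfolding nn_integral_fibres[OF maps, of "\<lambda>y. ennreal ((cmod (g y))\<^sup>2)"]
    by (simp add: nn_integral_cmult fibre_def)
  also have "\<dots> < \<infinity>"
    using g by (simp add: L2_space_iff_nn ennreal_mult_less_top)
  finally show ?thesis by (simp add: L2_space_iff_nn)
qed

text \<open>
  On the fibre of \<open>x\<close> the function \<open>f \<circ> \<phi>\<close> has the constant value \<open>f x\<close>, which can be pulled out
  of the integral over that fibre.
\<close>

lemma weighted_average_adjoint:
  assumes f: "f \<in> L2_space M" and g: "g \<in> L2_space M"
  shows "L2_inner M (composition_operator \<phi> f) g = L2_inner M f (weighted_average g)"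
proof -
  have "L2_inner M (composition_operator \<phi> f) g = (LINT y|M. f (\<phi> y) * cnj (g y))"
    by (simp add: L2_inner_def composition_operator_def)
  also have "\<dots> = (LINT x|count_space (space M). (LINT y:fibre x|M. f (\<phi> y) * cnj (g y)))"
    unfolding fibre_def
    by (rule integral_fibres[OF maps integrable_L2_mult[OF composition_L2[OF f] g]])
  also have "\<dots> = (LINT x|count_space (space M).
      of_real (measure M {x}) * (f x * cnj (weighted_average g x)))"
  proof (rule Bochner_Integration.integral_cong)
    fix x assume "x \<in> space (count_space (space M))"
    then have m: "measure M {x} \<noteq> 0" using measure_atom_pos[of x] by simp
    have "(LINT y:fibre x|M. f (\<phi> y) * cnj (g y)) = (LINT y|M. f x * cnj (indicator (fibre x) y *\<^sub>R g y))"
      unfolding set_lebesgue_integral_def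
      by (intro Bochner_Integration.integral_cong) (auto simp: fibre_def split: split_indicator)
    also have "\<dots> = f x * cnj (LINT y:fibre x|M. g y)"
      unfolding set_lebesgue_integral_def by (simp only: integral_mult_right_zero Bochner_Integration.integral_cnj)
    also have "\<dots> = of_real (measure M {x}) * (f x * cnj (weighted_average g x))"
      using m by (simp add: weighted_average_def)
    finally show "(LINT y:fibre x|M. f (\<phi> y) * cnj (g y)) =
      of_real (measure M {x}) * (f x * cnj (weighted_average g x))" .
  qed simp
  also have "\<dots> = L2_inner M f (weighted_average g)"
    unfolding L2_inner_def
    by (rule integral_atoms[symmetric]) (rule integrable_L2_mult[OF f weighted_average_L2[OF g]])
  finally show ?thesis .
qed

lemma L2_inner_atom:
  assumes "x \<in> space M"
  shows "L2_inner M (indicator {x}) k = of_real (measure M {x}) * cnj (k x)"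
proof -
  have "L2_inner M (indicator {x}) k = (LINT y:{x}|M. cnj (k y))"
    unfolding L2_inner_def set_lebesgue_integral_def
    by (intro Bochner_Integration.integral_cong) (auto split: split_indicator)
  then show ?thesis using assms by (simp add: set_integral_atom)
qed

text \<open>
  The weighted average witnesses that a function with the defining property of the adjoint exists;
  testing with indicators of points shows that any such function agrees with it everywhere.
\<close>

lemma
  assumes g: "g \<in> L2_space M"
  shows adjoint_L2_space: "adjoint_L2 M (composition_operator \<phi>) g \<in> L2_space M"
    and adjoint_eq: "x \<in> space M \<Longrightarrow> adjoint_L2 M (composition_operator \<phi>) g x = weighted_average g x"
proof -
  let ?k = "adjoint_L2 M (composition_operator \<phi>) g"
  have *: "?k \<in> L2_space M \<and>
      (\<forall>f\<in>L2_space M. L2_inner M (composition_operator \<phi> f) g = L2_inner M f ?k)"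
    unfolding adjoint_L2_def
    by (rule someI[of _ "weighted_average g"])
      (use weighted_average_L2[OF g] weighted_average_adjoint[OF _ g] in blast)
  then show "?k \<in> L2_space M" ..
  from * have k: "\<And>f. f \<in> L2_space M \<Longrightarrow> L2_inner M (composition_operator \<phi> f) g = L2_inner M f ?k"
    by blast
  assume x: "x \<in> space M"
  have "L2_inner M (indicator {x}) ?k = L2_inner M (indicator {x}) (weighted_average g)"
    using k[OF indicator_atom_L2[OF x]] weighted_average_adjoint[OF indicator_atom_L2[OF x] g] by simp
  then show "?k x = weighted_average g x"
    using measure_atom_pos[OF x] by (simp add: L2_inner_atom[OF x])
qed

lemma null_space_adjoint_iff:
  "f \<in> null_space_L2 M (adjoint_L2 M (composition_operator \<phi>)) \<longleftrightarrow>
    f \<in> L2_space M \<and> (\<forall>x\<in>space M. (LINT y:fibre x|M. f y) = 0)"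
proof -
  have "(adjoint_L2 M (composition_operator \<phi>) f x = 0) \<longleftrightarrow> (LINT y:fibre x|M. f y) = 0"
    if "f \<in> L2_space M" "x \<in> space M" for x
    using measure_atom_pos[OF that(2)] by (simp add: adjoint_eq[OF that] weighted_average_def)
  then show ?thesis
    by (auto simp: null_space_L2_def AE_iff_all)
qed

lemma adjoint_composition:
  fixes f :: "'a \<Rightarrow> complex"
  assumes f: "f \<in> L2_space M" and x: "x \<in> space M"
  shows "adjoint_L2 M (composition_operator \<phi>) (composition_operator \<phi> f) x = fibre_ratio x * f x"
proof -
  have "(LINT y:fibre x|M. f (\<phi> y)) = (LINT y|M. indicator (fibre x) y *\<^sub>R f x)"
    unfolding set_lebesgue_integral_def
    by (intro Bochner_Integration.integral_cong) (auto simp: fibre_def split: split_indicator)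
  also have "\<dots> = measure M (fibre x) *\<^sub>R f x"
    using fibre_finite[OF x] fibre_subset[of x]
    by (intro has_bochner_integral_integral_eq has_bochner_integral_indicator) (auto simp: sets_eq)
  finally have *: "(LINT y:fibre x|M. f (\<phi> y)) = measure M (fibre x) *\<^sub>R f x" .
  have "composition_operator \<phi> f = (\<lambda>y. f (\<phi> y))"
    by (simp add: composition_operator_def comp_def)
  then show ?thesis
    using adjoint_eq[OF composition_L2[OF f] x] *
    by (simp add: weighted_average_def fibre_ratio_def scaleR_conv_of_real)
qed

text \<open>
  \<open>C\<^sup>* C\<close> multiplies by \<open>fibre_ratio\<close>, and the null space of \<open>C\<^sup>*\<close> is cut out by the vanishing of
  all fibre integrals, so the condition can be tested on one fibre at a time.
\<close>

lemma kernel_condition_iff: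
  "kernel_condition M (composition_operator \<phi>) \<longleftrightarrow>
    (\<forall>y\<in>space M. \<forall>z\<in>space M. \<phi> y = \<phi> z \<longrightarrow> fibre_ratio y = fibre_ratio z)"
    (is "?K \<longleftrightarrow> ?R")
proof -
  let ?T = "composition_operator \<phi>"
  let ?A = "adjoint_L2 M ?T"
  have AT_L2: "?A (?T f) \<in> L2_space M" if "f \<in> L2_space M" for f
    using adjoint_L2_space[OF composition_L2[OF that]] by (simp add: composition_operator_def comp_def)
  have K: "?K \<longleftrightarrow> (\<forall>f\<in>null_space_L2 M ?A. \<forall>x\<in>space M. (LINT y:fibre x|M. fibre_ratio y * f y) = 0)"
  proof -
    have "(LINT y:fibre x|M. ?A (?T f) y) = (LINT y:fibre x|M. fibre_ratio y * f y)"
      if "f \<in> L2_space M" for f :: "'a \<Rightarrow> complex" and x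
      unfolding set_lebesgue_integral_def
      by (intro Bochner_Integration.integral_cong) (simp_all only: adjoint_composition[OF that])
    then show ?thesis
      unfolding kernel_condition_def by (auto simp: null_space_adjoint_iff image_subset_iff AT_L2)
  qed
  show ?thesis
  proof
    assume ?K
    show ?R
    proof (intro ballI impI)
      fix y z assume y: "y \<in> space M" and z: "z \<in> space M" and yz: "\<phi> y = \<phi> z"
      define f :: "'a \<Rightarrow> complex" where
        "f = (\<lambda>w. indicator {y} w / measure M {y} - indicator {z} w / measure M {z})"
      \<comment> \<open>Needed with \<open>c = 1\<close>, for membership in the null space, and with \<open>c = fibre_ratio\<close>.\<close>
      have int: "(LINT w:fibre x|M. c w * f w) =
          (if \<phi> y = x then c y else 0) - (if \<phi> z = x then c z else 0)" for c x
      proof -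
        define u where "u v = (\<lambda>w. indicator {v} w *\<^sub>R ((if \<phi> v = x then c v else 0) / measure M {v}) :: complex)" for v
        have u: "has_bochner_integral M (u v) (if \<phi> v = x then c v else 0)" if "v \<in> space M" for v
        proof -
          have "has_bochner_integral M (u v) (measure M {v} *\<^sub>R ((if \<phi> v = x then c v else 0) / measure M {v}))"
            unfolding u_def using that atoms[OF that]
            by (intro has_bochner_integral_indicator) (auto simp: sets_eq)
          then show ?thesis
            using measure_atom_pos[OF that] by (simp add: scaleR_conv_of_real split: if_splits)
        qed
        have "(LINT w:fibre x|M. c w * f w) = (LINT w|M. u y w - u z w)"
          unfolding set_lebesgue_integral_def using y z
          by (intro Bochner_Integration.integral_cong)
            (auto simp: f_def u_def fibre_def divide_simps split: split_indicator)
        also have "\<dots> = (if \<phi> y = x then c y else 0) - (if \<phi> z = x then c z else 0)"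
          by (intro has_bochner_integral_integral_eq has_bochner_integral_diff u y z)
        finally show ?thesis .
      qed
      have f_L2: "f \<in> L2_space M"
      proof -
        have "emeasure M {y, z} \<le> emeasure M {y} + emeasure M {z}"
          using y z emeasure_subadditive[of "{y}" M "{z}"] by (simp add: sets_eq insert_commute)
        also have "\<dots> < \<infinity>"
          using atoms[OF y] atoms[OF z] by simp
        finally have fin: "emeasure M {y, z} < \<infinity>" .
        have "integrable M (\<lambda>w. (1 / measure M {y} + 1 / measure M {z})\<^sup>2 * indicator {y, z} w)"
          using y z fin
          by (intro integrable_mult_right integrable_real_indicator)
            (auto simp: sets_eq)
        then show ?thesis
          unfolding L2_space_iff
        proof (rule Bochner_Integration.integrable_bound)
          show "AE w in M. norm ((cmod (f w))\<^sup>2) \<le>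
            norm ((1 / measure M {y} + 1 / measure M {z})\<^sup>2 * indicator {y, z} w)"
          proof (rule AE_I2)
            fix w
            have "cmod (f w) \<le> (1 / measure M {y} + 1 / measure M {z}) * indicator {y, z} w"
              unfolding f_def norm_of_real
              by (rule order_trans[OF abs_triangle_ineq4]) (auto split: split_indicator)
            then have "(cmod (f w))\<^sup>2 \<le> ((1 / measure M {y} + 1 / measure M {z}) * indicator {y, z} w)\<^sup>2"
              by (intro power_mono) auto
            then show "norm ((cmod (f w))\<^sup>2) \<le>
              norm ((1 / measure M {y} + 1 / measure M {z})\<^sup>2 * indicator {y, z} w)"
              by (auto split: split_indicator)
          qed
        qed simp
      qed
      have "f \<in> null_space_L2 M ?A"
        using int[of _ "\<lambda>_. 1"] yz f_L2 by (auto simp: null_space_adjoint_iff)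
      moreover have "\<phi> y \<in> space M" using maps y by auto
      ultimately have "(LINT w:fibre (\<phi> y)|M. fibre_ratio w * f w) = 0"
        using \<open>?K\<close> K by blast
      then show "fibre_ratio y = fibre_ratio z"
        unfolding int[of "\<phi> y" "\<lambda>w. complex_of_real (fibre_ratio w)"] using yz by simp
    qed
  next
    assume R: ?R
    show ?K
      unfolding K
    proof (intro ballI)
      fix f x assume f: "f \<in> null_space_L2 M ?A" and x: "x \<in> space M"
      obtain c where c: "\<And>y. y \<in> fibre x \<Longrightarrow> fibre_ratio y = c"
        using R unfolding fibre_def by (metis (mono_tags, lifting) mem_Collect_eq)
      have "(LINT y:fibre x|M. fibre_ratio y * f y) = (LINT y:fibre x|M. c * f y)"
        unfolding set_lebesgue_integral_def
        by (intro Bochner_Integration.integral_cong) (auto simp: c split: split_indicator)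
      also have "\<dots> = 0"
        using f x by (simp add: null_space_adjoint_iff)
      finally show "(LINT y:fibre x|M. fibre_ratio y * f y) = 0" .
    qed
  qed
qed

lemma pushforward_density_eq_iff:
  assumes "y \<in> space M" "z \<in> space M"
  shows "pushforward_density M \<phi> y = pushforward_density M \<phi> z \<longleftrightarrow> fibre_ratio y = fibre_ratio z"
proof -
  have "pushforward_density M \<phi> x = ennreal (fibre_ratio x)" if x: "x \<in> space M" for x
  proof -
    have "pushforward_density M \<phi> x = emeasure M (\<phi> -` {x} \<inter> space M) / emeasure M {x}"
      using countable_space sets_eq atoms maps x by (rule pushforward_density_eq)
    also have "\<phi> -` {x} \<inter> space M = fibre x"
      by (auto simp: fibre_def)
    finally show ?thesis
      using emeasure_eq_ennreal_measure[of M "fibre x", OF less_imp_neq] emeasure_atom[OF x]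
        fibre_finite[OF x] measure_atom_pos[OF x]
      by (simp add: fibre_ratio_def divide_ennreal)
  qed
  then show ?thesis
    using assms by (simp add: fibre_ratio_def)
qed

end

section \<open>The graph with one circuit\<close>

lemma countable_vertices: "countable (vertices \<kappa> \<eta>)"
proof (rule countable_subset)
  show "vertices \<kappa> \<eta> \<subseteq> range Circ \<union> range (\<lambda>(r, i, j). Branch r i j)"
    by (auto simp: vertices_def image_iff)
qed simp

lemma Circ_successor_exists:
  assumes "s \<in> {1..\<kappa>}"
  obtains r where "r \<in> {1..\<kappa>}" "s = Phi2 \<kappa> (1 + int r)"
proof
  show r: "(if s = 1 then \<kappa> else s - 1) \<in> {1..\<kappa>}" using assms by auto
  show "s = Phi2 \<kappa> (1 + int (if s = 1 then \<kappa> else s - 1))"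
    unfolding Phi2_Suc[OF r] using assms by auto
qed

text \<open>
  Vertices sorted by their parent. A circuit vertex is written as the successor of \<open>x\<^sub>r\<close>, because
  \<open>parent\<close> inverts the successor map on the circuit.
\<close>

lemma vertices_cases:
  assumes "x \<in> vertices \<kappa> \<eta>"
  obtains (circuit) r where "r \<in> {1..\<kappa>}" "x = Circ (Phi2 \<kappa> (1 + int r))" "parent \<kappa> x = Circ r"
  | (first) r i where "r \<in> {1..\<kappa>}" "i \<in> J1 (\<eta> r)" "x = Branch r i 1" "parent \<kappa> x = Circ r"
  | (later) r i j where "r \<in> {1..\<kappa>}" "i \<in> J1 (\<eta> r)" "1 \<le> j" "x = Branch r i (Suc j)"
      "parent \<kappa> x = Branch r i j"
proof -
  from assms consider s where "s \<in> {1..\<kappa>}" "x = Circ s"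
    | r i j where "r \<in> {1..\<kappa>}" "i \<in> J1 (\<eta> r)" "1 \<le> j" "x = Branch r i j"
    by (auto simp: vertices_def)
  then show thesis
  proof cases
    case 1
    from Circ_successor_exists[OF 1(1)] obtain r where "r \<in> {1..\<kappa>}" "s = Phi2 \<kappa> (1 + int r)" .
    then show thesis using circuit 1 parent_Circ_Phi2 by blast
  next
    case 2
    show thesis
    proof (cases "j = 1")
      case True
      then show thesis using first 2 by simp
    next
      case False
      then show thesis using later[of r i "j - 1"] 2 by simp
    qed
  qed
qed

lemma Circ_in_vertices: "r \<in> {1..\<kappa>} \<Longrightarrow> Circ r \<in> vertices \<kappa> \<eta>"
  and Branch_in_vertices:
    "r \<in> {1..\<kappa>} \<Longrightarrow> i \<in> J1 (\<eta> r) \<Longrightarrow> 1 \<le> j \<Longrightarrow> Branch r i j \<in> vertices \<kappa> \<eta>"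
  by (auto simp: vertices_def)

lemma Phi2_in_range: "r \<in> {1..\<kappa>} \<Longrightarrow> Phi2 \<kappa> (1 + int r) \<in> {1..\<kappa>}"
  by (subst Phi2_Suc) auto

lemma parent_in_vertices: "x \<in> vertices \<kappa> \<eta> \<Longrightarrow> parent \<kappa> x \<in> vertices \<kappa> \<eta>"
  by (erule vertices_cases) (auto simp: Circ_in_vertices Branch_in_vertices)

text \<open>
  The only vertices with siblings are the children of the circuit vertices: the successor of \<open>x\<^sub>r\<close>
  on the circuit, to which every other child of \<open>x\<^sub>r\<close> is compared, and the first vertices of the
  branches at \<open>x\<^sub>r\<close>.
\<close>

lemma constant_on_siblings_iff:
  "(\<forall>y\<in>vertices \<kappa> \<eta>. \<forall>z\<in>vertices \<kappa> \<eta>. parent \<kappa> y = parent \<kappa> z \<longrightarrow> h y = h z) \<longleftrightarrow>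
    (\<forall>r\<in>{1..\<kappa>}. \<forall>i\<in>J1 (\<eta> r). h (Circ (Phi2 \<kappa> (1 + int r))) = h (Branch r i 1))"
    (is "?L \<longleftrightarrow> ?R")
proof
  assume L: ?L
  show ?R
  proof (intro ballI)
    fix r i assume r: "r \<in> {1..\<kappa>}" and i: "i \<in> J1 (\<eta> r)"
    have "Branch r i 1 \<in> vertices \<kappa> \<eta>"
      using r i by (simp add: Branch_in_vertices)
    moreover have "parent \<kappa> (Circ (Phi2 \<kappa> (1 + int r))) = parent \<kappa> (Branch r i 1)"
      by (simp only: parent_Circ_Phi2[OF r]) simp
    ultimately show "h (Circ (Phi2 \<kappa> (1 + int r))) = h (Branch r i 1)"
      using L[rule_format, OF Circ_in_vertices[OF Phi2_in_range[OF r]]] by simp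
  qed
next
  assume R: ?R
  show ?L
  proof (intro ballI impI)
    fix y z assume y: "y \<in> vertices \<kappa> \<eta>" and z: "z \<in> vertices \<kappa> \<eta>" and eq: "parent \<kappa> y = parent \<kappa> z"
    from y show "h y = h z"
    proof (cases rule: vertices_cases)
      case (circuit r)
      from z show ?thesis by (cases rule: vertices_cases) (use circuit eq R in auto)
    next
      case y_first: (first r i)
      have hy: "h (Circ (Phi2 \<kappa> (1 + int r))) = h y"
        using R y_first by blast
      from z show ?thesis
      proof (cases rule: vertices_cases)
        case (circuit s)
        then show ?thesis using y_first eq hy by simp
      next
        case (first s k)
        moreover from this have "s = r" using y_first eq by simp
        ultimately have "h (Circ (Phi2 \<kappa> (1 + int r))) = h z"
          using R by blast
        then show ?thesis using hy by simp
      next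
        case (later s k j)
        then show ?thesis using y_first eq by simp
      qed
    next
      case (later r i j)
      from z show ?thesis by (cases rule: vertices_cases) (use later eq in auto)
    qed
  qed
qed

theorem theorem2p14:
  fixes \<kappa> :: nat and \<eta> :: "nat \<Rightarrow> enat" and M :: "vertex measure"
  assumes "1 \<le> \<kappa>"
    and "\<exists>r\<in>{1..\<kappa>}. \<eta> r \<noteq> 0"
    and "space M = vertices \<kappa> \<eta>"
    and "sets M = Pow (vertices \<kappa> \<eta>)"
    and "\<forall>x\<in>vertices \<kappa> \<eta>. 0 < emeasure M {x} \<and> emeasure M {x} < \<infinity>"
    and "bounded_operator_L2 M (composition_operator (parent \<kappa>))"
    and "quasi_2_isometry M (composition_operator (parent \<kappa>))"
  shows
    "(\<kappa> = 1 \<longrightarrow>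
       (kernel_condition M (composition_operator (parent \<kappa>)) \<longleftrightarrow>
         (\<forall>i\<in>J1 (\<eta> 1). pushforward_density M (parent \<kappa>) (Circ 1) =
                        pushforward_density M (parent \<kappa>) (Branch 1 i 1)))) \<and>
     (\<kappa> = 2 \<longrightarrow>
       (kernel_condition M (composition_operator (parent \<kappa>)) \<longleftrightarrow>
         (\<forall>i\<in>J1 (\<eta> 2). pushforward_density M (parent \<kappa>) (Circ 1) =
                        pushforward_density M (parent \<kappa>) (Branch 2 i 1)) \<and>
         (\<forall>i\<in>J1 (\<eta> 1). pushforward_density M (parent \<kappa>) (Circ 2) =
                        pushforward_density M (parent \<kappa>) (Branch 1 i 1))))"
proof -
  let ?h = "pushforward_density M (parent \<kappa>)"
  interpret bounded_composition M "parent \<kappa>"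
    using assms(3-6) parent_in_vertices countable_vertices by unfold_locales auto
  have "kernel_condition M (composition_operator (parent \<kappa>)) \<longleftrightarrow>
    (\<forall>y\<in>vertices \<kappa> \<eta>. \<forall>z\<in>vertices \<kappa> \<eta>. parent \<kappa> y = parent \<kappa> z \<longrightarrow> ?h y = ?h z)"
    using pushforward_density_eq_iff unfolding kernel_condition_iff assms(3) by blast
  also have "\<dots> \<longleftrightarrow> (\<forall>r\<in>{1..\<kappa>}. \<forall>i\<in>J1 (\<eta> r). ?h (Circ (Phi2 \<kappa> (1 + int r))) = ?h (Branch r i 1))"
    by (rule constant_on_siblings_iff)
  also have "\<dots> \<longleftrightarrow>
    (\<forall>r\<in>{1..\<kappa>}. \<forall>i\<in>J1 (\<eta> r). ?h (Circ (if r = \<kappa> then 1 else r + 1)) = ?h (Branch r i 1))"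
    by (intro ball_cong refl) (simp only: Phi2_Suc)
  finally have main: "kernel_condition M (composition_operator (parent \<kappa>)) \<longleftrightarrow>
    (\<forall>r\<in>{1..\<kappa>}. \<forall>i\<in>J1 (\<eta> r). ?h (Circ (if r = \<kappa> then 1 else r + 1)) = ?h (Branch r i 1))" .
  have "{1..1} = {1::nat}" "{1..2} = {1, 2::nat}" by auto
  then show ?thesis
    unfolding main by (auto simp: numeral_2_eq_2)
qed

end
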